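(* Let $G$ be a finite semiprimitive permutation group. Then all plinths of $G$ have the same multiset of composition factors.
   Context: A permutation group is semiregular if all its point-stabilisers are trivial. A transitive permutation group is semiprimitive if every normal subgroup is transitive or semiregular. A plinth of a transitive group $G$ is a transitive normal subgroup $K$ of $G$ such that no proper subgroup of $K$ that is normal in $G$ is transitive. *)

theory Defs
  imports "HOL-Algebra.Algebra" "HOL-Library.Multiset"
begin

section \<open>Permutation groups\<close>

text \<open>A permutation group on \<open>S\<close> is given by its underlying set, a subgroup of \<open>BijGroup S\<close>;
  \<open>perm_group S H\<close> is the corresponding group structure. It acts on \<open>S\<close> by \<open>\<lambda>g. g\<close>.\<close>

abbreviation perm_group :: "'a set \<Rightarrow> ('a \<Rightarrow> 'a) set \<Rightarrow> ('a \<Rightarrow> 'a) monoid" where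
  "perm_group S H \<equiv> (BijGroup S)\<lparr>carrier := H\<rparr>"

definition transitive_on :: "'a set \<Rightarrow> ('a \<Rightarrow> 'a) set \<Rightarrow> bool" where
  "transitive_on S H \<longleftrightarrow> transitive_action (perm_group S H) S (\<lambda>g. g)"

definition semiregular_on :: "'a set \<Rightarrow> ('a \<Rightarrow> 'a) set \<Rightarrow> bool" where
  "semiregular_on S H \<longleftrightarrow>
     (\<forall>x\<in>S. stabilizer (perm_group S H) (\<lambda>g. g) x = {\<one>\<^bsub>BijGroup S\<^esub>})"

definition semiprimitive_on :: "'a set \<Rightarrow> ('a \<Rightarrow> 'a) set \<Rightarrow> bool" where
  "semiprimitive_on S G \<longleftrightarrow> transitive_on S G \<and>
     (\<forall>N. N \<lhd> perm_group S G \<longrightarrow> transitive_on S N \<or> semiregular_on S N)"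

definition plinth :: "'a set \<Rightarrow> ('a \<Rightarrow> 'a) set \<Rightarrow> ('a \<Rightarrow> 'a) set \<Rightarrow> bool" where
  "plinth S G K \<longleftrightarrow> K \<lhd> perm_group S G \<and> transitive_on S K \<and>
     \<not> (\<exists>N. N \<subset> K \<and> N \<lhd> perm_group S G \<and> transitive_on S N)"


section \<open>Composition factors\<close>

text \<open>Series are listed in ascending order, from the trivial subgroup to the whole group.
  The locale \<open>simple_group\<close> only admits finite groups, as \<open>order\<close> is \<open>0\<close> for infinite ones, so
  the notions below are the usual ones for finite groups only.\<close>

definition composition_series :: "('a, 'b) monoid_scheme \<Rightarrow> 'a set list \<Rightarrow> bool" where
  "composition_series G Hs \<longleftrightarrow>
     Hs \<noteq> [] \<and> hd Hs = {\<one>\<^bsub>G\<^esub>} \<and> last Hs = carrier G \<and>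
     (\<forall>i. Suc i < length Hs \<longrightarrow>
        Hs ! i \<lhd> G\<lparr>carrier := Hs ! Suc i\<rparr> \<and>
        simple_group (G\<lparr>carrier := Hs ! Suc i\<rparr> Mod (Hs ! i)))"

text \<open>Isomorphism classes are taken within one type of groups. The groups compared below are
  quotients of permutation groups on the same set, so they all live in the same type.\<close>

definition iso_class :: "'a monoid \<Rightarrow> 'a monoid set" where
  "iso_class Q = {R. group R \<and> R \<cong> Q}"

definition series_factors :: "('a, 'b) monoid_scheme \<Rightarrow> 'a set list \<Rightarrow> 'a set monoid set multiset"
  where
  "series_factors G Hs =
     mset (map (\<lambda>i. iso_class (G\<lparr>carrier := Hs ! Suc i\<rparr> Mod (Hs ! i))) [0..<length Hs - 1])"

text \<open>\<open>M\<close> is the multiset of factors of some composition series of \<open>G\<close>. Uniqueness of \<open>M\<close>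
  is the theorem of Jordan and Hoelder and is not built into the definition.\<close>

definition has_composition_factors ::
  "('a, 'b) monoid_scheme \<Rightarrow> 'a set monoid set multiset \<Rightarrow> bool" where
  "has_composition_factors G M \<longleftrightarrow> (\<exists>Hs. composition_series G Hs \<and> M = series_factors G Hs)"

end

theory Submission
  imports Defs
begin

text \<open>If \<open>K\<close> and \<open>L\<close> are distinct plinths, then \<open>N = K \<inter> L\<close> is an intransitive normal subgroup, and
  so is the subgroup \<open>Y\<close> of all elements of \<open>G\<close> preserving every \<open>N\<close>-orbit; hence \<open>Y\<close> is
  semiregular. An element \<open>k\<close> of \<open>K\<close> fixing a point \<open>w\<close> lies in \<open>Y\<close>: every point is of the form
  \<open>l w\<close> with \<open>l \<in> L\<close>, and \<open>k (l w) = [k, l] (l w)\<close> with \<open>[k, l] \<in> N\<close>. So \<open>k\<close> is trivial, that is,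
  \<open>K\<close> is regular, and by symmetry so is \<open>L\<close>. Thus both plinths are normal complements of a point
  stabiliser \<open>G\<^sub>w\<close>, and by Jordan--Hoelder the composition factors of \<open>G\<close> are those of \<open>G\<^sub>w\<close>
  together with those of \<open>K\<close>, and likewise for \<open>L\<close>.\<close>

section \<open>Jordan--Hoelder for finite groups\<close>

lemma iso_class_cong:
  assumes "group P" "group Q" "P \<cong> Q"
  shows "iso_class P = iso_class Q"
  using assms group.iso_sym iso_trans unfolding iso_class_def by blast

lemma composition_series_singleton:
  "composition_series G [H] \<longleftrightarrow> H = {\<one>\<^bsub>G\<^esub>} \<and> H = carrier G"
  by (auto simp: composition_series_def)

text \<open>Peeling at the top leaves a series of a subgroup, that is, of the same structure with a
  smaller carrier. Peeling at the bottom would lead to quotients, whose elements have another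
  type.\<close>

lemma composition_series_snoc:
  assumes "Hs \<noteq> []"
  shows "composition_series G (Hs @ [H]) \<longleftrightarrow>
    H = carrier G \<and> last Hs \<lhd> G \<and> simple_group (G Mod last Hs) \<and>
    composition_series (G\<lparr>carrier := last Hs\<rparr>) Hs"
proof -
  \<comment> \<open>The only index that \<open>Hs @ [H]\<close> adds to the condition is
    \<open>length Hs - 1\<close>, where the consecutive pair is \<open>last Hs\<close>,
    \<open>H\<close>.\<close>
  have last: "Hs ! (length Hs - 1) = last Hs"
    using assms by (simp add: last_conv_nth)
  have "(\<forall>i. Suc i < length (Hs @ [H]) \<longrightarrow> P ((Hs @ [H]) ! i) ((Hs @ [H]) ! Suc i)) \<longleftrightarrow>
    P (last Hs) H \<and> (\<forall>i. Suc i < length Hs \<longrightarrow> P (Hs ! i) (Hs ! Suc i))" (is "?l P \<longleftrightarrow> ?r P") for P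
  proof
    assume l: "?l P"
    have "P (last Hs) H"
      using spec[OF l, of "length Hs - 1"] assms last by (simp add: nth_append)
    moreover have "P (Hs ! i) (Hs ! Suc i)" if "Suc i < length Hs" for i
      using spec[OF l, of i] that by (simp add: nth_append)
    ultimately show "?r P"
      by blast
  next
    assume r: "?r P"
    show "?l P"
    proof (intro allI impI)
      fix i assume i: "Suc i < length (Hs @ [H])"
      show "P ((Hs @ [H]) ! i) ((Hs @ [H]) ! Suc i)"
      proof (cases "Suc i < length Hs")
        case True
        then show ?thesis using r by (simp add: nth_append)
      next
        case False
        then have "i = length Hs - 1" "Suc i = length Hs" using i by auto
        then show ?thesis using r last assms by (simp add: nth_append)
      qed
    qed
  qed
  from this[of "\<lambda>A B. A \<lhd> G\<lparr>carrier := B\<rparr> \<and> simple_group (G\<lparr>carrier := B\<rparr> Mod A)"]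
  show ?thesis
    using assms unfolding composition_series_def by auto
qed

lemma series_factors_snoc:
  assumes "Hs \<noteq> []"
  shows "series_factors G (Hs @ [carrier G]) =
    add_mset (iso_class (G Mod last Hs)) (series_factors (G\<lparr>carrier := last Hs\<rparr>) Hs)"
proof -
  obtain n where n: "length Hs = Suc n"
    using assms by (cases Hs) auto
  have "Hs ! n = last Hs"
    using n assms by (simp add: last_conv_nth)
  moreover have "map (\<lambda>i. iso_class (G\<lparr>carrier := (Hs @ [carrier G]) ! Suc i\<rparr> Mod (Hs @ [carrier G]) ! i)) [0..<n] =
    map (\<lambda>i. iso_class (G\<lparr>carrier := Hs ! Suc i\<rparr> Mod Hs ! i)) [0..<n]"
    using n by (intro map_cong) (auto simp: nth_append)
  ultimately show ?thesis
    unfolding series_factors_def using n by (simp add: nth_append del: mset_map map_eq_conv)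
qed

text \<open>This recursion replaces lists in all later arguments: a series is either trivial or has
  a topmost simple quotient above a series of a normal subgroup.\<close>

lemma has_composition_factors_iff:
  "has_composition_factors G M \<longleftrightarrow>
     carrier G = {\<one>\<^bsub>G\<^esub>} \<and> M = {#} \<or>
     (\<exists>N M'. N \<lhd> G \<and> simple_group (G Mod N) \<and>
        has_composition_factors (G\<lparr>carrier := N\<rparr>) M' \<and> M = add_mset (iso_class (G Mod N)) M')"
    (is "?l \<longleftrightarrow> ?triv \<or> ?step")
proof
  assume ?l
  then obtain Hs where Hs: "composition_series G Hs" "M = series_factors G Hs"
    unfolding has_composition_factors_def by blast
  then have "Hs \<noteq> []"
    by (simp add: composition_series_def)
  then obtain Hs' H where eq: "Hs = Hs' @ [H]"
    by (metis rev_exhaust)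
  show "?triv \<or> ?step"
  proof (cases "Hs' = []")
    case True
    then show ?thesis
      using Hs eq by (auto simp: composition_series_singleton series_factors_def)
  next
    case False
    then show ?thesis
      using Hs unfolding eq composition_series_snoc[OF False]
      by (auto simp: series_factors_snoc has_composition_factors_def)
  qed
next
  assume "?triv \<or> ?step"
  then show ?l
  proof
    assume ?triv
    then have "composition_series G [carrier G]" "M = series_factors G [carrier G]"
      by (auto simp: composition_series_singleton series_factors_def)
    then show ?l
      unfolding has_composition_factors_def by blast
  next
    assume ?step
    then obtain N Hs where N: "N \<lhd> G" "simple_group (G Mod N)"
      and Hs: "composition_series (G\<lparr>carrier := N\<rparr>) Hs"
      and M: "M = add_mset (iso_class (G Mod N)) (series_factors (G\<lparr>carrier := N\<rparr>) Hs)"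
      unfolding has_composition_factors_def by blast
    have "Hs \<noteq> []" "last Hs = N"
      using Hs by (auto simp: composition_series_def)
    then have "composition_series G (Hs @ [carrier G])" "M = series_factors G (Hs @ [carrier G])"
      using N Hs M by (simp_all add: composition_series_snoc series_factors_snoc)
    then show ?l
      unfolding has_composition_factors_def by blast
  qed
qed

lemma has_composition_factors_trivial:
  "carrier G = {\<one>\<^bsub>G\<^esub>} \<Longrightarrow> has_composition_factors G {#}"
  by (subst has_composition_factors_iff) simp

lemma has_composition_factors_step:
  assumes "N \<lhd> G" "simple_group (G Mod N)" "has_composition_factors (G\<lparr>carrier := N\<rparr>) M"
  shows "has_composition_factors G (add_mset (iso_class (G Mod N)) M)"
  using assms by (subst has_composition_factors_iff) blast

section \<open>Simple quotients and maximal normal subgroups\<close>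

lemma (in normal) simple_factor_imp_proper:
  assumes "simple_group (G Mod H)"
  shows "H \<noteq> carrier G"
  using assms group.self_factor_not_simple[OF is_group] by metis

text \<open>By the correspondence theorem \<open>B\<close> gives the normal subgroup
  \<open>B / H\<close> of the simple group \<open>G / H\<close>, which has to be trivial or
  everything.\<close>

lemma (in normal) simple_factor_imp_maximal:
  assumes "simple_group (G Mod H)" "B \<lhd> G" "H \<subseteq> B"
  shows "B = H \<or> B = carrier G"
proof -
  let ?A = "rcosets\<^bsub>G\<lparr>carrier := B\<rparr>\<^esub> H"
  interpret B: normal B G by fact
  \<comment> \<open>As \<open>B\<close> contains \<open>H\<close>, it is the full preimage of
    \<open>?A\<close> and can be recovered from it.\<close>
  have B: "B = {x \<in> carrier G. H #> x \<in> ?A}"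
  proof (intro equalityI subsetI CollectI conjI)
    fix x assume "x \<in> B"
    then show "x \<in> carrier G" "H #> x \<in> ?A"
      using B.subset by (auto simp: RCOSETS_def r_coset_def)
  next
    fix x assume x: "x \<in> {x \<in> carrier G. H #> x \<in> ?A}"
    then obtain b where b: "b \<in> B" "H #> x = H #> b"
      by (auto simp: RCOSETS_def r_coset_def)
    then have "x \<in> H #> b"
      using x rcos_self subgroup_axioms by blast
    then show "x \<in> B"
      using assms(3) b(1) by (auto simp: r_coset_def)
  qed
  have "?A \<lhd> G Mod H"
    using normality_factorization[OF normal_axioms assms(3,2)] .
  then consider "?A = carrier (G Mod H)" | "?A = {H}"
    using simple_group.no_real_normal_subgroup[OF assms(1)] by fastforce
  then show ?thesis
  proof cases
    case 1
    have "H #> x \<in> carrier (G Mod H)" if "x \<in> carrier G" for x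
      using that by (auto simp: carrier_FactGroup)
    then have "B = carrier G"
      using B.subset B unfolding 1 by blast
    then show ?thesis ..
  next
    case 2
    have "x \<in> H" if "x \<in> B" for x
    proof -
      have "x \<in> carrier G" "H #> x \<in> {H}"
        using that B 2 by blast+
      then show ?thesis
        using rcos_self[OF _ subgroup_axioms] by force
    qed
    then have "B = H"
      using assms(3) by blast
    then show ?thesis ..
  qed
qed

text \<open>Finiteness provides a maximal proper normal subgroup, and the correspondence theorem
  turns its maximality into simplicity of the quotient.\<close>

lemma (in group) exists_simple_factor:
  assumes "finite (carrier G)" "carrier G \<noteq> {\<one>}"
  shows "\<exists>N. N \<lhd> G \<and> simple_group (G Mod N)"
proof -
  let ?F = "{N. N \<lhd> G \<and> N \<noteq> carrier G}"
  have "?F \<subseteq> Pow (carrier G)"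
    using normal_imp_subgroup subgroup.subset by fastforce
  then have "finite ?F"
    using assms(1) finite_subset by blast
  moreover have "{\<one>} \<in> ?F"
    using assms(2) one_is_normal by auto
  ultimately obtain N where N: "N \<in> ?F" and "\<forall>B\<in>?F. N \<subseteq> B \<longrightarrow> N = B"
    using finite_has_maximal2[of ?F "{\<one>}"] by meson
  then have max: "B = N" if "B \<in> ?F" "N \<subseteq> B" for B
    using that by metis
  interpret N: normal N G using N by simp
  have fin: "finite (carrier (G Mod N))"
    using assms(1) by (simp add: carrier_FactGroup)
  have "simple_group (G Mod N)"
    unfolding simple_group_def simple_group_axioms_def
  proof (intro conjI allI impI N.factorgroup_is_group)
    \<comment> \<open>Properness of \<open>N\<close> excludes order 1; finiteness excludes the value
      0 that \<open>order\<close> takes on infinite groups.\<close>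
    have "order (G Mod N) \<noteq> 1"
      using N N.fact_group_trivial_iff[OF assms(1)] group.order_one_triv_iff[OF N.factorgroup_is_group]
      by simp
    moreover have "0 < order (G Mod N)"
      using fin N.factorgroup_is_group group.is_monoid monoid.order_gt_0_iff_finite by blast
    ultimately show "1 < order (G Mod N)"
      by simp
  next
    fix A assume A: "A \<lhd> G Mod N"
    then have sub: "subgroup A (G Mod N)"
      by (rule normal_imp_subgroup)
    \<comment> \<open>The union of the cosets in \<open>A\<close> is the preimage of
      \<open>A\<close> in \<open>G\<close>, a normal subgroup to which maximality of
      \<open>N\<close> applies.\<close>
    have U: "\<Union>A \<lhd> G"
      using A by (rule N.factgroup_subgroup_union_normal)
    have "N \<in> A"
      using subgroup.one_closed[OF sub] by simp
    then have "N \<subseteq> \<Union>A"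
      by blast
    then consider "\<Union>A = carrier G" | "\<Union>A = N"
      using max[of "\<Union>A"] U by blast
    then show "A = carrier (G Mod N) \<or> A = {\<one>\<^bsub>G Mod N\<^esub>}"
    proof cases
      case 1
      then show ?thesis
        using N.factgroup_subgroup_union_factor[OF sub] by (simp add: FactGroup_def)
    next
      case 2
      have "A = rcosets\<^bsub>G\<lparr>carrier := N\<rparr>\<^esub> N"
        using N.factgroup_subgroup_union_factor[OF sub] 2 by simp
      also have "\<dots> = (\<lambda>a. N #> a) ` N"
        by (auto simp: RCOSETS_def)
      also have "\<dots> = (\<lambda>a. N) ` N"
        by (rule image_cong) (simp_all add: N.rcos_const[OF is_group])
      also have "\<dots> = {N}"
        using subgroup.one_closed[OF N.subgroup_axioms] by blast
      finally show ?thesis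
        by simp
    qed
  qed
  then show ?thesis
    using N by blast
qed

lemma card_normal_simple_factor_less:
  assumes "finite (carrier G)" "N \<lhd> G" "simple_group (G Mod N)"
  shows "card N < card (carrier G)"
proof -
  have "N \<subset> carrier G"
    using normal.simple_factor_imp_proper[OF assms(2,3)] subgroup.subset[OF normal_imp_subgroup[OF assms(2)]]
    by blast
  then show ?thesis
    using assms(1) by (rule psubset_card_mono[rotated])
qed

section \<open>Existence and uniqueness of the composition factors\<close>

lemma exists_composition_factors:
  fixes G :: "('a, 'b) monoid_scheme"
  assumes "group G" "finite (carrier G)"
  shows "\<exists>M. has_composition_factors G M"
  using assms
proof (induction "card (carrier G)" arbitrary: G rule: less_induct)
  case less
  show ?case
  proof (cases "carrier G = {\<one>\<^bsub>G\<^esub>}")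
    case True
    then show ?thesis
      using has_composition_factors_trivial by blast
  next
    case False
    then obtain N where N: "N \<lhd> G" "simple_group (G Mod N)"
      using group.exists_simple_factor less.prems by blast
    have sub: "subgroup N G"
      using N(1) by (rule normal_imp_subgroup)
    have "\<exists>M. has_composition_factors (G\<lparr>carrier := N\<rparr>) M"
    proof (rule less.hyps)
      show "card (carrier (G\<lparr>carrier := N\<rparr>)) < card (carrier G)"
        using card_normal_simple_factor_less[OF less.prems(2) N] by simp
      show "group (G\<lparr>carrier := N\<rparr>)"
        using group.subgroup_imp_group[OF less.prems(1) sub] .
      show "finite (carrier (G\<lparr>carrier := N\<rparr>))"
        using less.prems(2) subgroup.subset[OF sub] finite_subset by auto
    qed
    then show ?thesis
      using has_composition_factors_step[OF N] by blast
  qed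
qed

text \<open>For factors supplied by the second isomorphism theorem, which are known only up to
  isomorphism: both simplicity and the isomorphism class carry over.\<close>

lemma (in group) has_composition_factors_step_iso:
  assumes "N \<lhd> G" "simple_group Q" "Q \<cong> G Mod N"
    and "has_composition_factors (G\<lparr>carrier := N\<rparr>) M"
  shows "has_composition_factors G (add_mset (iso_class Q) M)"
proof -
  have gr: "group (G Mod N)"
    using assms(1) by (rule normal.factorgroup_is_group)
  have "simple_group (G Mod N)"
    using assms(2,3) gr simple_group.iso_simple by (auto simp: is_iso_def)
  moreover have "iso_class Q = iso_class (G Mod N)"
    using simple_group.axioms(1)[OF assms(2)] gr assms(3) by (rule iso_class_cong)
  ultimately show ?thesis
    using has_composition_factors_step assms(1,4) by metis
qed

text \<open>A trivial group has no proper subgroup, hence no topmost simple factor.\<close>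

lemma composition_factors_trivial_unique:
  assumes "has_composition_factors G M" "carrier G = {\<one>\<^bsub>G\<^esub>}"
  shows "M = {#}"
proof -
  have False if N: "N \<lhd> G" "simple_group (G Mod N)" for N
  proof -
    have "\<one>\<^bsub>G\<^esub> \<in> N" "N \<subseteq> carrier G"
      using subgroup.one_closed subgroup.subset normal_imp_subgroup[OF N(1)] by blast+
    then have "N = carrier G"
      using assms(2) by auto
    then show False
      using normal.simple_factor_imp_proper[OF N] by blast
  qed
  then show ?thesis
    using assms(1) by (subst (asm) has_composition_factors_iff) blast
qed

text \<open>Induction on the order. If the top terms \<open>N\<close> and \<open>L\<close> of two
  series differ, both series are compared with ones passing through
  \<open>N \<inter> L\<close>.\<close>

theorem composition_factors_unique:
  fixes G :: "('a, 'b) monoid_scheme"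
  assumes "group G" "finite (carrier G)" "has_composition_factors G A" "has_composition_factors G B"
  shows "A = B"
  using assms
proof (induction "card (carrier G)" arbitrary: G A B rule: less_induct)
  case less
  interpret group G by (rule less.prems)
  show ?case
  proof (cases "carrier G = {\<one>\<^bsub>G\<^esub>}")
    case True
    then show ?thesis
      using composition_factors_trivial_unique less.prems by metis
  next
    case False
    obtain N A' where N: "N \<lhd> G" "simple_group (G Mod N)"
      and A': "has_composition_factors (G\<lparr>carrier := N\<rparr>) A'"
      and A: "A = add_mset (iso_class (G Mod N)) A'"
      using less.prems(3) False by (subst (asm) has_composition_factors_iff) blast
    obtain L B' where L: "L \<lhd> G" "simple_group (G Mod L)"
      and B': "has_composition_factors (G\<lparr>carrier := L\<rparr>) B'"
      and B: "B = add_mset (iso_class (G Mod L)) B'"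
      using less.prems(4) False by (subst (asm) has_composition_factors_iff) blast
    interpret N: normal N G by (rule N)
    interpret L: normal L G by (rule L)
    have IH: "U = V" if "H \<lhd> G" "simple_group (G Mod H)"
      "has_composition_factors (G\<lparr>carrier := H\<rparr>) U" "has_composition_factors (G\<lparr>carrier := H\<rparr>) V"
      for H U V
    proof (rule less.hyps[of "G\<lparr>carrier := H\<rparr>"])
      have sub: "subgroup H G"
        using that(1) by (rule normal_imp_subgroup)
      show "card (carrier (G\<lparr>carrier := H\<rparr>)) < card (carrier G)"
        using card_normal_simple_factor_less[OF less.prems(2) that(1,2)] by simp
      show "group (G\<lparr>carrier := H\<rparr>)"
        using subgroup_imp_group[OF sub] .
      show "finite (carrier (G\<lparr>carrier := H\<rparr>))"
        using less.prems(2) subgroup.subset[OF sub] finite_subset by auto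
    qed (use that in auto)
    show ?thesis
    proof (cases "N = L")
      case True
      then show ?thesis
        using IH[OF N] A A' B B' by simp
    next
      case False
      \<comment> \<open>The second isomorphism theorem is used twice, with the roles of the normal
        subgroup and of the other subgroup exchanged.\<close>
      interpret NL: second_isomorphism_grp N G L
        by unfold_locales
      interpret LN: second_isomorphism_grp L G N
        by unfold_locales
      have "N <#>\<^bsub>G\<^esub> L = L <#>\<^bsub>G\<^esub> N"
        using commut_normal[OF L.is_subgroup N(1)] by simp
      moreover have NL_normal: "N <#>\<^bsub>G\<^esub> L \<lhd> G"
        using normal_subgroup_set_mult_closed[OF N(1) L(1)] .
      \<comment> \<open>Both subgroups are maximal normal, so if their product were proper it would
        equal each of them, against \<open>N \<noteq> L\<close>.\<close>
      have "N <#>\<^bsub>G\<^esub> L = N \<or> N <#>\<^bsub>G\<^esub> L = carrier G"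
        using N.simple_factor_imp_maximal[OF N(2) NL_normal NL.H_contained_in_set_mult] .
      moreover have "N <#>\<^bsub>G\<^esub> L = L \<or> N <#>\<^bsub>G\<^esub> L = carrier G"
        using L.simple_factor_imp_maximal[OF L(2) NL_normal NL.S_contained_in_set_mult] .
      ultimately have NL: "N <#>\<^bsub>G\<^esub> L = carrier G" "L <#>\<^bsub>G\<^esub> N = carrier G"
        using False by metis+
      define D where "D = N \<inter> L"
      have D: "D \<lhd> G\<lparr>carrier := N\<rparr>" "D \<lhd> G\<lparr>carrier := L\<rparr>"
        unfolding D_def using LN.normal_subgrp_intersection_normal NL.normal_subgrp_intersection_normal
        by (simp_all add: Int_commute)
      have iso: "G Mod N \<cong> G\<lparr>carrier := L\<rparr> Mod D" "G Mod L \<cong> G\<lparr>carrier := N\<rparr> Mod D"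
      proof -
        have "G\<lparr>carrier := L\<rparr> Mod D \<cong> G Mod N" "G\<lparr>carrier := N\<rparr> Mod D \<cong> G Mod L"
          using NL.normal_intersection_quotient_isom LN.normal_intersection_quotient_isom NL
          unfolding is_iso_def D_def by (auto simp: Int_commute)
        moreover have "group (G\<lparr>carrier := L\<rparr> Mod D)" "group (G\<lparr>carrier := N\<rparr> Mod D)"
          using D normal.factorgroup_is_group by blast+
        ultimately show "G Mod N \<cong> G\<lparr>carrier := L\<rparr> Mod D" "G Mod L \<cong> G\<lparr>carrier := N\<rparr> Mod D"
          using group.iso_sym by blast+
      qed
      have "subgroup D G"
        unfolding D_def using subgroups_Inter_pair N.is_subgroup L.is_subgroup by blast
      \<comment> \<open>Putting one series of \<open>D\<close> below both \<open>N\<close> and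
        \<open>L\<close> gives each of them a series whose top factor is the quotient of
        \<open>G\<close> by the other one; the induction hypothesis identifies these with
        \<open>A'\<close> and \<open>B'\<close>.\<close>
      then obtain C where C: "has_composition_factors (G\<lparr>carrier := D\<rparr>) C"
        using exists_composition_factors[of "G\<lparr>carrier := D\<rparr>"] subgroup_imp_group less.prems(2)
          subgroup.subset finite_subset by fastforce
      have "has_composition_factors (G\<lparr>carrier := N\<rparr>) (add_mset (iso_class (G Mod L)) C)"
        using group.has_composition_factors_step_iso[OF subgroup_imp_group[OF N.is_subgroup] D(1)
          L(2) iso(2)] C by simp
      then have "A' = add_mset (iso_class (G Mod L)) C"
        using IH[OF N A'] by blast
      moreover have "has_composition_factors (G\<lparr>carrier := L\<rparr>) (add_mset (iso_class (G Mod N)) C)"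
        using group.has_composition_factors_step_iso[OF subgroup_imp_group[OF L.is_subgroup] D(2)
          N(2) iso(1)] C by simp
      then have "B' = add_mset (iso_class (G Mod N)) C"
        using IH[OF L B'] by blast
      ultimately show ?thesis
        using A B by simp
    qed
  qed
qed

section \<open>Composition factors of a product with trivial intersection\<close>

lemma (in normal) set_mult_normal:
  assumes D: "subgroup D G" and E: "E \<lhd> G\<lparr>carrier := D\<rparr>"
  shows "H <#> E \<lhd> G\<lparr>carrier := H <#> D\<rparr>"
proof -
  interpret D: second_isomorphism_grp H G D
    by (simp add: second_isomorphism_grp_def second_isomorphism_grp_axioms_def D normal_axioms)
  have ED: "subgroup E (G\<lparr>carrier := D\<rparr>)"
    using E by (rule normal_imp_subgroup)
  then have EG: "subgroup E G" "E \<subseteq> D"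
    using incl_subgroup[OF D] subgroup.subset by fastforce+
  interpret E: second_isomorphism_grp H G E
    by (simp add: second_isomorphism_grp_def second_isomorphism_grp_axioms_def EG normal_axioms)
  have HD: "subgroup (H <#> D) G" and HE: "subgroup (H <#> E) G"
    using D.normal_set_mult_subgroup E.normal_set_mult_subgroup .
  have sub: "subgroup (H <#> E) (G\<lparr>carrier := H <#> D\<rparr>)"
    using subgroup_incl[OF HE HD] mono_set_mult EG(2) by blast
  have H: "H \<subseteq> H <#> E" and E': "E \<subseteq> H <#> E"
    using E.H_contained_in_set_mult E.S_contained_in_set_mult .
  show ?thesis
  proof (rule group.normal_invI[OF subgroup_imp_group[OF HD] sub])
    fix x y
    assume "x \<in> carrier (G\<lparr>carrier := H <#> D\<rparr>)" and y: "y \<in> H <#> E"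
    then obtain h d where h: "h \<in> H" and d: "d \<in> D" and x: "x = h \<otimes> d"
      by (auto simp: set_mult_def)
    obtain k e where k: "k \<in> H" and e: "e \<in> E" and y: "y = k \<otimes> e"
      using y by (auto simp: set_mult_def)
    have c: "h \<in> carrier G" "d \<in> carrier G" "k \<in> carrier G" "e \<in> carrier G"
      using h d k e subgroup.mem_carrier[OF D] subgroup.mem_carrier[OF EG(1)] by auto
    \<comment> \<open>Conjugation by \<open>h \<otimes> d\<close> is split: \<open>d\<close>
      normalises both \<open>H\<close> and \<open>E\<close>, and the conjugation by \<open>h\<close>
      that remains takes place inside \<open>H <#> E\<close>.\<close>
    have "d \<otimes> k \<otimes> inv d \<in> H <#> E"
      using inv_op_closed2[OF c(2) k] H by blast
    moreover have "d \<otimes> e \<otimes> inv d \<in> E"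
      using normal.inv_op_closed2[OF E, of d e] d e D by simp
    ultimately have "h \<otimes> (d \<otimes> k \<otimes> inv d) \<otimes> (d \<otimes> e \<otimes> inv d) \<otimes> inv h \<in> H <#> E"
      using h H E' subgroup.m_closed[OF HE] subgroup.m_inv_closed[OF HE] by (meson subsetD)
    also have "h \<otimes> (d \<otimes> k \<otimes> inv d) \<otimes> (d \<otimes> e \<otimes> inv d) \<otimes> inv h = x \<otimes> y \<otimes> inv x"
      unfolding x y using c by (simp add: m_assoc inv_mult_group inv_solve_left')
    finally show "x \<otimes>\<^bsub>G\<lparr>carrier := H <#> D\<rparr>\<^esub> y \<otimes>\<^bsub>G\<lparr>carrier := H <#> D\<rparr>\<^esub> inv\<^bsub>G\<lparr>carrier := H <#> D\<rparr>\<^esub> x \<in> H <#> E"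
      using HD \<open>x \<in> carrier _\<close> by simp
  qed
qed

text \<open>A series of \<open>D\<close> is lifted term by term above a series of \<open>H\<close>:
  each \<open>E\<close> becomes \<open>H <#> E\<close>, and the successive quotients stay the same
  up to isomorphism.\<close>

lemma (in normal) has_composition_factors_set_mult:
  assumes "has_composition_factors (G\<lparr>carrier := H\<rparr>) A" "has_composition_factors (G\<lparr>carrier := D\<rparr>) B"
    and "subgroup D G" "H \<inter> D = {\<one>}"
  shows "has_composition_factors (G\<lparr>carrier := H <#> D\<rparr>) (A + B)"
  using assms(2-)
proof (induction "size B" arbitrary: B D rule: less_induct)
  case less
  show ?case
  \<comment> \<open>The case is exactly the first alternative of
    \<open>has_composition_factors_iff\<close>, so its negation yields a top factor of
    \<open>D\<close>.\<close>
  proof (cases "D = {\<one>} \<and> B = {#}")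
    case True
    then have "H <#> D = H"
      using subset by (auto simp: set_mult_def)
    then show ?thesis
      using assms(1) True by simp
  next
    case False
    obtain E B' where E: "E \<lhd> G\<lparr>carrier := D\<rparr>" "simple_group (G\<lparr>carrier := D\<rparr> Mod E)"
      and B': "has_composition_factors (G\<lparr>carrier := E\<rparr>) B'"
      and B: "B = add_mset (iso_class (G\<lparr>carrier := D\<rparr> Mod E)) B'"
      using less.prems(1) False by (subst (asm) has_composition_factors_iff) auto
    have D: "subgroup D G"
      by (rule less.prems)
    interpret D: second_isomorphism_grp H G D
      by (simp add: second_isomorphism_grp_def second_isomorphism_grp_axioms_def D normal_axioms)
    have ED: "subgroup E (G\<lparr>carrier := D\<rparr>)"
      using E(1) by (rule normal_imp_subgroup)
    then have EG: "subgroup E G" "E \<subseteq> D"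
      using incl_subgroup[OF D] subgroup.subset by fastforce+
    have one: "\<one> \<in> E" "\<one> \<in> H"
      using EG(1) subgroup_axioms subgroup.one_closed by auto
    let ?P = "G\<lparr>carrier := H <#> D\<rparr>"
    have HD: "subgroup (H <#> D) G"
      by (rule D.normal_set_mult_subgroup)
    have DP: "subgroup D ?P"
      using subgroup_incl[OF D HD D.S_contained_in_set_mult] .
    have normal: "H <#> E \<lhd> ?P"
      using set_mult_normal[OF D E(1)] .
    \<comment> \<open>The second isomorphism theorem inside \<open>H <#> D\<close> will give
      \<open>D / E\<close> as the quotient by \<open>H <#> E\<close>, once the intersection and the
      product with \<open>D\<close> are computed.\<close>
    interpret P: second_isomorphism_grp "H <#> E" ?P D
      using normal DP by (simp add: second_isomorphism_grp_def second_isomorphism_grp_axioms_def)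
    \<comment> \<open>An instance of Dedekind's modular law; the trivial intersection of
      \<open>H\<close> and \<open>D\<close> enters here.\<close>
    have int: "(H <#> E) \<inter> D = E"
    proof (intro equalityI subsetI)
      fix x assume "x \<in> (H <#> E) \<inter> D"
      then obtain h e where x: "h \<in> H" "e \<in> E" "x = h \<otimes> e" "x \<in> D"
        by (auto simp: set_mult_def)
      then have "x \<otimes> inv e \<in> D"
        using EG(2) by (intro subgroup.m_closed[OF D] subgroup.m_inv_closed[OF D]) auto
      moreover have c: "h \<in> carrier G" "e \<in> carrier G"
        using x EG(1) subgroup.mem_carrier by auto
      then have "x \<otimes> inv e = h"
        using x(3) by (simp add: m_assoc)
      ultimately have "h = \<one>"
        using x(1) less.prems(3) by blast
      then show "x \<in> E"
        using x c by simp
    next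
      fix x assume x: "x \<in> E"
      then have "x = \<one> \<otimes> x"
        using EG(1) subgroup.mem_carrier by fastforce
      then show "x \<in> (H <#> E) \<inter> D"
        using x one EG(2) by (auto simp: set_mult_def)
    qed
    have "H <#> E <#> D = H <#> D"
    proof -
      have "E <#> D = D"
      proof (intro equalityI subsetI)
        fix x assume "x \<in> E <#> D"
        then show "x \<in> D"
          using EG(2) D subgroup.m_closed by (fastforce simp: set_mult_def)
      next
        fix x assume x: "x \<in> D"
        then have "x = \<one> \<otimes> x"
          using D subgroup.mem_carrier by fastforce
        then show "x \<in> E <#> D"
          using x one by (auto simp: set_mult_def)
      qed
      then show ?thesis
        using set_mult_assoc[of H E D] subset EG(1) D subgroup.subset by metis
    qed
    then have "G\<lparr>carrier := D\<rparr> Mod E \<cong> ?P Mod (H <#> E)"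
      using P.normal_intersection_quotient_isom int unfolding is_iso_def by auto
    moreover have "has_composition_factors (G\<lparr>carrier := H <#> E\<rparr>) (A + B')"
      using less.hyps[of B' E] B B' EG less.prems(3) one by auto
    ultimately have "has_composition_factors ?P (add_mset (iso_class (G\<lparr>carrier := D\<rparr> Mod E)) (A + B'))"
      using group.has_composition_factors_step_iso[OF subgroup_imp_group[OF HD] normal
          E(2)] by simp
    then show ?thesis
      using B by simp
  qed
qed


section \<open>Permutation groups\<close>

lemma transitive_on_iff:
  assumes "subgroup H (BijGroup S)"
  shows "transitive_on S H \<longleftrightarrow> (\<forall>x\<in>S. \<forall>y\<in>S. \<exists>g\<in>H. g x = y)"
proof -
  have "group_hom (perm_group S H) (BijGroup S) (\<lambda>g. g)"
    using assms group.subgroup_imp_group[OF group_BijGroup] group_BijGroup subgroup.subset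
    by (fastforce simp: group_hom_def group_hom_axioms_def hom_def)
  then show ?thesis
    by (auto simp: transitive_on_def transitive_action_def transitive_action_axioms_def group_action_def)
qed

lemma semiregular_onD:
  assumes "semiregular_on S H" "x \<in> S" "g \<in> H" "g x = x"
  shows "g = \<one>\<^bsub>BijGroup S\<^esub>"
  using assms by (auto simp: semiregular_on_def stabilizer_def)

lemma plinth_eqI:
  assumes "plinth S G K" "plinth S G L" "K \<subseteq> L"
  shows "K = L"
  using assms unfolding plinth_def by blast

lemma distinct_plinths_imp_regular:
  assumes G: "subgroup G (BijGroup S)" and sp: "semiprimitive_on S G"
    and K: "plinth S G K" and L: "plinth S G L" and "K \<noteq> L"
    and w: "w \<in> S" and k: "k \<in> K" "k w = w"
  shows "k = \<one>\<^bsub>BijGroup S\<^esub>"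
proof -
  let ?B = "BijGroup S" and ?A = "perm_group S G"
  interpret B: group ?B by (rule group_BijGroup)
  interpret A: group ?A by (rule B.subgroup_imp_group[OF G])
  interpret A: group_action ?A S "\<lambda>g. g"
    using sp by (simp add: semiprimitive_on_def transitive_on_def transitive_action_def)
  define N where "N = K \<inter> L"
  have K': "K \<lhd> ?A" and L': "L \<lhd> ?A"
    using K L by (auto simp: plinth_def)
  have sub: "subgroup H ?B" if "H \<lhd> ?A" for H
    using B.incl_subgroup[OF G normal_imp_subgroup[OF that]] .
  have subG: "H \<subseteq> G" if "H \<lhd> ?A" for H
    using subgroup.subset[OF normal_imp_subgroup[OF that]] by simp
  have mult: "(g \<otimes>\<^bsub>?B\<^esub> h) x = g (h x)" if "g \<in> G" "h \<in> G" "x \<in> S" for g h x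
    using A.composition_rule that by simp
  have closed: "g x \<in> S" if "g \<in> G" "x \<in> S" for g x
    using A.element_image that by simp
  have inv: "inv\<^bsub>?B\<^esub> g \<in> G" "(inv\<^bsub>?B\<^esub> g) (g x) = x" "g ((inv\<^bsub>?B\<^esub> g) x) = x"
    if "g \<in> G" "x \<in> S" for g x
  proof -
    show i: "inv\<^bsub>?B\<^esub> g \<in> G"
      using subgroup.m_inv_closed[OF G that(1)] .
    show "(inv\<^bsub>?B\<^esub> g) (g x) = x"
      using A.orbit_sym_aux[of g x] that G by simp
    show "g ((inv\<^bsub>?B\<^esub> g) x) = x"
      using A.orbit_sym_aux[of "inv\<^bsub>?B\<^esub> g" x] i that G subgroup.mem_carrier[OF G that(1)] by simp
  qed
  have conj: "g \<otimes>\<^bsub>?B\<^esub> h \<otimes>\<^bsub>?B\<^esub> inv\<^bsub>?B\<^esub> g \<in> H" if "H \<lhd> ?A" "g \<in> G" "h \<in> H" for H g h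
    using A.normal_invE(2)[OF that(1), of g h] that G by simp
  have N': "N \<lhd> ?A"
    unfolding N_def by (rule A.normal_subgroup_intersect[OF K' L'])
  \<comment> \<open>Otherwise \<open>K \<subseteq> L\<close>, and minimality of \<open>L\<close>
    would give equality. Minimality of \<open>K\<close> then makes \<open>N\<close>
    intransitive.\<close>
  have "N \<subset> K"
    using plinth_eqI[OF K L] \<open>K \<noteq> L\<close> unfolding N_def by blast
  then have N_intrans: "\<not> transitive_on S N"
    using K N' by (auto simp: plinth_def)
  \<comment> \<open>The kernel of the action of \<open>G\<close> on the set of
    \<open>N\<close>-orbits; the element \<open>n\<close> may depend on the point
    \<open>x\<close>.\<close>
  define Y where "Y = {g. g \<in> G \<and> (\<forall>x\<in>S. \<exists>n\<in>N. g x = n x)}"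
  have Y_D: "\<exists>n\<in>N. g x = n x" if "g \<in> Y" "x \<in> S" for g x
    using that unfolding Y_def by blast
  have Y_inv: "inv\<^bsub>?B\<^esub> g \<in> Y" if gY: "g \<in> Y" for g
    unfolding Y_def
  proof (intro CollectI conjI ballI)
    have g: "g \<in> G"
      using that by (simp add: Y_def)
    show "inv\<^bsub>?B\<^esub> g \<in> G"
      using subgroup.m_inv_closed[OF G g] .
    fix x assume x: "x \<in> S"
    let ?y = "(inv\<^bsub>?B\<^esub> g) x"
    have y: "?y \<in> S"
      using closed inv(1)[OF g x] x .
    then obtain n where n: "n \<in> N" "g ?y = n ?y"
      using Y_D[OF gY y] by blast
    have nG: "n \<in> G"
      using n(1) subG[OF N'] by blast
    \<comment> \<open>Since \<open>n\<close> agrees with \<open>g\<close> at \<open>?y\<close>, it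
      sends \<open>?y\<close> to \<open>x\<close>, so its inverse is the required element of
      \<open>N\<close>.\<close>
    have "?y = (inv\<^bsub>?B\<^esub> n) (n ?y)"
      using inv(2)[OF nG y] by simp
    also have "n ?y = x"
      using n(2) inv(3)[OF g x] by simp
    finally show "\<exists>n\<in>N. ?y = n x"
      using subgroup.m_inv_closed[OF sub[OF N'] n(1)] by blast
  qed
  have Y_mult: "g \<otimes>\<^bsub>?B\<^esub> h \<in> Y" if gY: "g \<in> Y" and hY: "h \<in> Y" for g h
    unfolding Y_def
  proof (intro CollectI conjI ballI)
    have g: "g \<in> G" and h: "h \<in> G"
      using gY hY by (simp_all add: Y_def)
    show "g \<otimes>\<^bsub>?B\<^esub> h \<in> G"
      using subgroup.m_closed[OF G g h] .
    fix x assume x: "x \<in> S"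
    obtain m where m: "m \<in> N" "h x = m x"
      using Y_D[OF hY x] by blast
    obtain n where n: "n \<in> N" "g (h x) = n (h x)"
      using Y_D[OF gY closed[OF h x]] by blast
    have "m \<in> G" "n \<in> G"
      using m n subG[OF N'] by blast+
    then have "(g \<otimes>\<^bsub>?B\<^esub> h) x = (n \<otimes>\<^bsub>?B\<^esub> m) x"
      using m n g h x by (simp add: mult)
    then show "\<exists>n\<in>N. (g \<otimes>\<^bsub>?B\<^esub> h) x = n x"
      using subgroup.m_closed[OF sub[OF N'] n(1) m(1)] by blast
  qed
  have Y: "Y \<lhd> ?A"
  proof (rule A.normal_invI)
    have "N \<subseteq> Y"
      using subG[OF N'] by (auto simp: Y_def)
    then show "subgroup Y ?A"
      using Y_inv Y_mult G subgroup.one_closed[OF sub[OF N']]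
      by (intro A.subgroupI) (auto simp: Y_def)
  next
    fix h g assume "h \<in> carrier ?A" and gX: "g \<in> Y"
    then have h: "h \<in> G" and g: "g \<in> G"
      by (simp_all add: Y_def)
    have hi: "inv\<^bsub>?B\<^esub> h \<in> G"
      using subgroup.m_inv_closed[OF G h] .
    have "\<exists>n\<in>N. (h \<otimes>\<^bsub>?B\<^esub> g \<otimes>\<^bsub>?B\<^esub> inv\<^bsub>?B\<^esub> h) x = n x" if x: "x \<in> S" for x
    proof -
      have y: "(inv\<^bsub>?B\<^esub> h) x \<in> S"
        using closed[OF hi x] .
      \<comment> \<open>The element of \<open>N\<close> is chosen at the point moved back by
        \<open>h\<close>; its conjugate by \<open>h\<close> then serves at \<open>x\<close>.\<close>
      then obtain n where n: "n \<in> N" "g ((inv\<^bsub>?B\<^esub> h) x) = n ((inv\<^bsub>?B\<^esub> h) x)"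
        using Y_D[OF gX y] by blast
      have "n \<in> G"
        using n(1) subG[OF N'] by blast
      then have "(h \<otimes>\<^bsub>?B\<^esub> g \<otimes>\<^bsub>?B\<^esub> inv\<^bsub>?B\<^esub> h) x = (h \<otimes>\<^bsub>?B\<^esub> n \<otimes>\<^bsub>?B\<^esub> inv\<^bsub>?B\<^esub> h) x"
        using n(2) g h hi x y by (simp add: mult subgroup.m_closed[OF G])
      then show ?thesis
        using conj[OF N' h n(1)] by blast
    qed
    then show "h \<otimes>\<^bsub>?A\<^esub> g \<otimes>\<^bsub>?A\<^esub> inv\<^bsub>?A\<^esub> h \<in> Y"
      using g h hi G by (simp add: Y_def subgroup.m_closed[OF G])
  qed
  \<comment> \<open>Every image of a point under \<open>Y\<close> is already an image under
    \<open>N\<close>.\<close>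
  have "\<not> transitive_on S Y"
    using N_intrans unfolding transitive_on_iff[OF sub[OF Y]] transitive_on_iff[OF sub[OF N']]
    by (fastforce simp: Y_def)
  then have semireg: "semiregular_on S Y"
    using sp Y by (auto simp: semiprimitive_on_def)
  have "k \<in> Y"
    unfolding Y_def
  proof (intro CollectI conjI ballI)
    show kG: "k \<in> G"
      using k(1) subG[OF K'] by blast
    fix x assume x: "x \<in> S"
    have "transitive_on S L"
      using L by (simp add: plinth_def)
    then obtain l where l: "l \<in> L" "l w = x"
      using w x unfolding transitive_on_iff[OF sub[OF L']] by blast
    have lG: "l \<in> G"
      using l(1) subG[OF L'] by blast
    \<comment> \<open>This commutator lies in \<open>L\<close> as a conjugate of \<open>l\<close>
      times the inverse of \<open>l\<close>, and in \<open>K\<close> as \<open>k\<close> times a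
      conjugate of the inverse of \<open>k\<close>.\<close>
    let ?n = "k \<otimes>\<^bsub>?B\<^esub> l \<otimes>\<^bsub>?B\<^esub> inv\<^bsub>?B\<^esub> k \<otimes>\<^bsub>?B\<^esub> inv\<^bsub>?B\<^esub> l"
    have "?n \<in> L"
      using conj[OF L' kG l(1)] l(1) sub[OF L'] subgroup.m_closed subgroup.m_inv_closed by metis
    moreover have "?n = k \<otimes>\<^bsub>?B\<^esub> (l \<otimes>\<^bsub>?B\<^esub> inv\<^bsub>?B\<^esub> k \<otimes>\<^bsub>?B\<^esub> inv\<^bsub>?B\<^esub> l)"
      using kG lG subgroup.mem_carrier[OF G] by (simp add: B.m_assoc)
    then have "?n \<in> K"
      using conj[OF K' lG, of "inv\<^bsub>?B\<^esub> k"] k(1) sub[OF K'] subgroup.m_closed subgroup.m_inv_closed by metis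
    \<comment> \<open>With \<open>x = l w\<close>, the inverse of \<open>l\<close> leads back to
      \<open>w\<close>, the inverse of \<open>k\<close> fixes \<open>w\<close>, and \<open>l\<close>
      followed by \<open>k\<close> gives \<open>k x\<close>.\<close>
    moreover have "?n x = k x"
      using l(2)[symmetric] kG lG w k inv[of k w] inv[of l w] closed subgroup.m_closed[OF G]
      by (simp add: mult)
    ultimately show "\<exists>n\<in>N. k x = n x"
      unfolding N_def by (metis IntI)
  qed
  then show ?thesis
    using semiregular_onD[OF semireg w] k(2) by blast
qed

section \<open>Point stabilisers as complements of regular normal subgroups\<close>

lemma perm_group_composition_factors_of_regular_normal:
  assumes "subgroup G (BijGroup S)" "transitive_on S G" "w \<in> S"
    and K: "K \<lhd> perm_group S G" "transitive_on S K"
    and reg: "\<And>k. k \<in> K \<Longrightarrow> k w = w \<Longrightarrow> k = \<one>\<^bsub>BijGroup S\<^esub>"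
    and A: "has_composition_factors (perm_group S K) A"
    and C: "has_composition_factors (perm_group S (stabilizer (perm_group S G) (\<lambda>g. g) w)) C"
  shows "has_composition_factors (perm_group S G) (A + C)"
proof -
  let ?A = "perm_group S G"
  let ?D = "stabilizer ?A (\<lambda>g. g) w"
  interpret B: group "BijGroup S" by (rule group_BijGroup)
  interpret A: transitive_action ?A S "\<lambda>g. g"
    using assms(2) by (simp add: transitive_on_def)
  interpret K: normal K ?A by (rule K)
  have KB: "subgroup K (BijGroup S)"
    using B.incl_subgroup[OF assms(1) K.is_subgroup] .
  have D: "subgroup ?D ?A"
    using A.stabilizer_subgroup[OF assms(3)] .
  have "k = \<one>\<^bsub>?A\<^esub>" if "k \<in> K" "k \<in> ?D" for k
    using reg[OF that(1)] that(2) by (simp add: stabilizer_def)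
  then have "K \<inter> ?D = {\<one>\<^bsub>?A\<^esub>}"
    using subgroup.one_closed[OF K.is_subgroup] subgroup.one_closed[OF D] by blast
  \<comment> \<open>Frattini argument: an element of \<open>K\<close> that agrees with
    \<open>g\<close> at \<open>w\<close> differs from \<open>g\<close> by an element of the
    stabiliser.\<close>
  moreover have "K <#>\<^bsub>?A\<^esub> ?D = G"
  proof (intro equalityI subsetI)
    fix x assume "x \<in> K <#>\<^bsub>?A\<^esub> ?D"
    then show "x \<in> G"
      using K.setmult_subset_G[OF K.subset subgroup.subset[OF D]] by auto
  next
    fix g assume g: "g \<in> G"
    then have "g w \<in> S"
      using A.element_image assms(3) by simp
    then obtain k where k: "k \<in> K" "k w = g w"
      using K(2) assms(3) unfolding transitive_on_iff[OF KB] by blast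
    have kG: "k \<in> carrier ?A" and gG: "g \<in> carrier ?A"
      using k K.subset g by auto
    have d: "inv\<^bsub>?A\<^esub> k \<otimes>\<^bsub>?A\<^esub> g \<in> carrier ?A"
      using kG gG by (intro K.m_closed K.inv_closed)
    have "(inv\<^bsub>?A\<^esub> k \<otimes>\<^bsub>?A\<^esub> g) w = w"
      using A.composition_rule[OF assms(3) K.inv_closed[OF kG] gG] A.orbit_sym_aux[OF kG assms(3) k(2)]
      by simp
    then have "inv\<^bsub>?A\<^esub> k \<otimes>\<^bsub>?A\<^esub> g \<in> ?D"
      using d by (simp add: stabilizer_def)
    moreover have "g = k \<otimes>\<^bsub>?A\<^esub> (inv\<^bsub>?A\<^esub> k \<otimes>\<^bsub>?A\<^esub> g)"
      using K.m_assoc[OF kG K.inv_closed[OF kG] gG] K.r_inv[OF kG] K.l_one[OF gG] by simp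
    ultimately show "g \<in> K <#>\<^bsub>?A\<^esub> ?D"
      using k(1) unfolding set_mult_def by blast
  qed
  ultimately show ?thesis
    using K.has_composition_factors_set_mult[of A ?D C] A C D by simp
qed

theorem corollary3p11:
  fixes S :: "'a set" and G :: "('a \<Rightarrow> 'a) set"
  assumes "subgroup G (BijGroup S)"
    and "finite G"
    and "semiprimitive_on S G"
  shows "\<exists>M. \<forall>K. plinth S G K \<longrightarrow>
           (\<forall>N. has_composition_factors (perm_group S K) N \<longleftrightarrow> N = M)"
proof -
  interpret B: group "BijGroup S" by (rule group_BijGroup)
  have sub: "subgroup K (BijGroup S)" "K \<subseteq> G" if "plinth S G K" for K
  proof -
    have "subgroup K (perm_group S G)"
      using that by (simp add: plinth_def normal_imp_subgroup)
    then show "subgroup K (BijGroup S)" "K \<subseteq> G"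
      using B.incl_subgroup[OF assms(1)] subgroup.subset by fastforce+
  qed
  have ex: "\<exists>M. has_composition_factors (perm_group S H) M" if "subgroup H (BijGroup S)" "H \<subseteq> G" for H
    using exists_composition_factors B.subgroup_imp_group[OF that(1)] finite_subset[OF that(2) assms(2)]
    by fastforce
  have uniq: "M = M'" if "subgroup H (BijGroup S)" "H \<subseteq> G"
    "has_composition_factors (perm_group S H) M" "has_composition_factors (perm_group S H) M'" for H M M'
    using composition_factors_unique[OF B.subgroup_imp_group[OF that(1)] _ that(3,4)]
      finite_subset[OF that(2) assms(2)] by simp
  have same: "M = M'" if K: "plinth S G K" and L: "plinth S G L"
    and M: "has_composition_factors (perm_group S K) M"
    and M': "has_composition_factors (perm_group S L) M'" for K L M M'
  proof (cases "K = L")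
    case True
    then show ?thesis
      using uniq sub[OF K] M M' by blast
  next
    case False
    \<comment> \<open>Transitivity is vacuous on the empty set, but there \<open>BijGroup S\<close>
      is trivial and cannot contain two distinct plinths.\<close>
    have "S \<noteq> {}"
    proof
      assume "S = {}"
      then have "carrier (BijGroup S) \<subseteq> {\<one>\<^bsub>BijGroup S\<^esub>}"
        by (auto simp: BijGroup_def Bij_def extensional_def)
      then have "H = {\<one>\<^bsub>BijGroup S\<^esub>}" if "subgroup H (BijGroup S)" for H
        using subgroup.one_closed[OF that] subgroup.subset[OF that] by blast
      then show False
        using False sub(1)[OF K] sub(1)[OF L] by metis
    qed
    then obtain w where w: "w \<in> S"
      by blast
    let ?D = "stabilizer (perm_group S G) (\<lambda>g. g) w"
    have trans: "transitive_on S G"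
      using assms(3) by (simp add: semiprimitive_on_def)
    have "subgroup ?D (perm_group S G)"
      using trans group_action.stabilizer_subgroup[OF _ w]
      by (auto simp: transitive_on_def transitive_action_def)
    then have "subgroup ?D (BijGroup S)" "?D \<subseteq> G"
      using B.incl_subgroup[OF assms(1)] subgroup.subset by fastforce+
    \<comment> \<open>The same multiset \<open>C\<close> complements \<open>M\<close> and
      \<open>M'\<close> in the factors of \<open>G\<close>, so uniqueness for \<open>G\<close>
      allows it to be cancelled.\<close>
    then obtain C where C: "has_composition_factors (perm_group S ?D) C"
      using ex by blast
    have "has_composition_factors (perm_group S G) (M + C)"
      using perm_group_composition_factors_of_regular_normal[OF assms(1) trans w _ _ _ M C] K
        distinct_plinths_imp_regular[OF assms(1,3) K L False w] by (simp add: plinth_def)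
    moreover have "has_composition_factors (perm_group S G) (M' + C)"
      using perm_group_composition_factors_of_regular_normal[OF assms(1) trans w _ _ _ M' C] L
        distinct_plinths_imp_regular[OF assms(1,3) L K False[symmetric] w] by (simp add: plinth_def)
    ultimately show ?thesis
      using uniq[OF assms(1) subset_refl] add_right_cancel by metis
  qed
  show ?thesis
  \<comment> \<open>The multiset is read off one chosen plinth; without plinths the claim is
    vacuous.\<close>
  proof (cases "\<exists>K. plinth S G K")
    case True
    then obtain K M where K: "plinth S G K" "has_composition_factors (perm_group S K) M"
      using ex sub by blast
    have "has_composition_factors (perm_group S L) A \<longleftrightarrow> A = M" if L: "plinth S G L" for L A
      using same[OF L K(1) _ K(2)] ex[OF sub[OF L]] by blast
    then show ?thesis
      by blast
  qed blast
qed

end
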